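(* Let $\gamma\in\mathbb{C}$ with $0<|\gamma|<1$. For every integer $n\ge N_\gamma$ and every $j\in\{1,\ldots,n\}$, there exists a unique $s_{\gamma,n,j}\in\mathcal{B}_{\gamma,n,j}$ that satisfies $$s_{\gamma,n,j}=\frac{j\pi}{n+1}+\frac{\vartheta_\gamma(s_{\gamma,n,j})}{n+1}.$$ Moreover, $\psi(s_{\gamma,n,j})$ is an eigenvalue of $A_{\gamma,n}$.
   Context: $A_{\gamma,n}$ is the $n\times n$ matrix $T_n(a)+\gamma E_{n,1,1}$, where $T_n(a)$ is the tridiagonal Toeplitz matrix with entries $(T_n(a))_{j+1,j}=1$, $(T_n(a))_{j,j+1}=-1$ and all other entries $0$, and $E_{n,1,1}$ has entry $(1,1)$ equal to $1$ and all other entries $0$. $\psi(z)=2i\cos(z)$. $\Delta_\gamma=\ln\frac{1}{|\gamma|}$. For $|\operatorname{Im}(z)|<\Delta_\gamma$, $$\vartheta_\gamma(z)=-\frac{i}{2}\ln\left(\frac{1+i\gamma e^{iz}}{1+i\gamma e^{-iz}}\right),$$ where $\ln$ is the principal branch of the logarithm on $\mathbb{C}\setminus(-\infty,0]$ (the argument of the logarithm lies in this set for all such $z$). Further, $$d_{n,j}=\frac{j\pi}{n+1},\qquad p_{\gamma,n,j}=d_{n,j}+\frac{\vartheta_\gamma(d_{n,j})}{n+1},\qquad M_\gamma=\frac{64\sqrt{|\gamma|}}{(1-|\gamma|)^3},\qquad N_\gamma=\frac{16}{(1-|\gamma|)^2},$$ $$\mathcal{B}_{\gamma,n,j}=\left\{z\in\mathbb{C}\colon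 |z-p_{\gamma,n,j}|<\frac{M_\gamma}{(n+1)^2}\right\}.$$ For $n\ge N_\gamma$ the disk $\mathcal{B}_{\gamma,n,j}$ is contained in the domain of $\vartheta_\gamma$. *)

theory Defs
  imports
    "HOL-Analysis.Complex_Transcendental"
    "Jordan_Normal_Form.Char_Poly"
begin

(* Matrix indices are 0-based here: entry (r, s) is entry (r + 1, s + 1) in the usual notation. *)

definition T_mat :: "nat \<Rightarrow> complex mat" where
  "T_mat n = mat n n (\<lambda>(r, s). if r = s + 1 then 1 else if s = r + 1 then - 1 else 0)"

definition E11_mat :: "nat \<Rightarrow> complex mat" where
  "E11_mat n = mat n n (\<lambda>(r, s). if r = 0 \<and> s = 0 then 1 else 0)"

definition A_mat :: "complex \<Rightarrow> nat \<Rightarrow> complex mat" where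
  "A_mat \<gamma> n = T_mat n + \<gamma> \<cdot>\<^sub>m E11_mat n"

definition psi :: "complex \<Rightarrow> complex" where
  "psi z = 2 * \<i> * cos z"

(* Meaningful for \<bar>Im z\<bar> < ln (1 / cmod \<gamma>). There both 1 + \<i> \<gamma> exp (\<plusminus> \<i> z) have positive real
   part, so the quotient avoids the nonpositive real axis, where Ln has its branch cut.
   Outside this strip the value is an artefact of totality. *)
definition vartheta :: "complex \<Rightarrow> complex \<Rightarrow> complex" where
  "vartheta \<gamma> z =
     - (\<i> / 2) * Ln ((1 + \<i> * \<gamma> * exp (\<i> * z)) / (1 + \<i> * \<gamma> * exp (- \<i> * z)))"

definition d_pt :: "nat \<Rightarrow> nat \<Rightarrow> real" where
  "d_pt n j = real j * pi / (real n + 1)"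

definition p_pt :: "complex \<Rightarrow> nat \<Rightarrow> nat \<Rightarrow> complex" where
  "p_pt \<gamma> n j = of_real (d_pt n j) + vartheta \<gamma> (of_real (d_pt n j)) / (of_nat n + 1)"

definition M_const :: "complex \<Rightarrow> real" where
  "M_const \<gamma> = 64 * sqrt (cmod \<gamma>) / (1 - cmod \<gamma>) ^ 3"

definition N_const :: "complex \<Rightarrow> real" where
  "N_const \<gamma> = 16 / (1 - cmod \<gamma>) ^ 2"

definition B_disk :: "complex \<Rightarrow> nat \<Rightarrow> nat \<Rightarrow> complex set" where
  "B_disk \<gamma> n j = ball (p_pt \<gamma> n j) (M_const \<gamma> / (real n + 1) ^ 2)"

end

theory Submission
  imports Defs
begin

text \<open>
  Write \<open>g = \<bar>\<gamma>\<bar>\<close> and let \<open>\<Phi> z = (j \<pi> + \<vartheta> z) / (n + 1)\<close>, so that the points in question are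
  the fixed points of \<open>\<Phi>\<close>. Two independent facts are combined.

  The map \<open>\<Phi>\<close> is a contraction. On the strip \<open>\<bar>Im z\<bar> \<le> Y\<close> the two terms \<open>\<i> \<gamma> exp (\<plusminus> \<i> z)\<close> have
  modulus at most \<open>c = g exp Y\<close>. If \<open>c < 1\<close>, then \<open>\<vartheta>\<close> is holomorphic there and its derivative is
  the mean of two quotients \<open>u / (1 + u)\<close> with \<open>\<bar>u\<bar> \<le> c\<close>, whence \<open>vartheta_Lipschitz\<close> with the
  constant \<open>c / (1 - c)\<close>. This is used for two values of \<open>Y\<close>. For \<open>Y = 0\<close> it bounds
  \<open>\<vartheta>\<close> on \<open>[0, \<pi>]\<close> by comparison with \<open>\<vartheta> 0 = 0\<close>, and hence the distance from \<open>d\<close> to the centre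
  \<open>p = \<Phi> d\<close>. For \<open>Y = (1 - g) / 2\<close> one has \<open>c \<le> sqrt g\<close>; the bound \<open>n \<ge> N\<close> forces the disk around
  \<open>p\<close> into this strip and makes the Lipschitz constant of \<open>\<Phi>\<close> at most \<open>1 / 8\<close>. Because \<open>p = \<Phi> d\<close>,
  the distance from \<open>\<Phi> z\<close> to \<open>p\<close> is controlled by the distance from \<open>z\<close> to \<open>d\<close>, so a closed disk
  around \<open>p\<close> is mapped into itself and Banach's theorem applies.

  A fixed point gives an eigenvalue. Exponentiating \<open>(n + 1) s = j \<pi> + \<vartheta> s\<close> turns it into
  \<open>sin ((n + 1) s) + \<i> \<gamma> sin (n s) = 0\<close> (\<open>sin_relation_if_exp_eq\<close>). The vector with entries
  \<open>(-\<i>) ^ k sin ((n - k) s)\<close> satisfies the eigenvalue equations of all rows but the first for any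
  \<open>s\<close>, and the first row is exactly this relation (\<open>eigenvalue_if_sin_relation\<close>). The vector is
  nonzero as soon as \<open>sin s \<noteq> 0\<close>; otherwise \<open>\<vartheta> s = 0\<close> and \<open>s\<close> would be the real number
  \<open>d = j \<pi> / (n + 1)\<close>, which lies strictly between \<open>0\<close> and \<open>\<pi>\<close>.
\<close>

section \<open>Eigenvectors of the perturbed Toeplitz matrix\<close>

text \<open>
  The factor \<open>(-\<i>) ^ k\<close> turns the antisymmetric recurrence of the matrix into
  \<open>w (k - 1) + w (k + 1) = 2 cos s * w k\<close>. Among its sine solutions, \<open>w k = sin ((n - k) s)\<close> is
  chosen because it vanishes at \<open>k = n\<close>, so that the last row causes no condition and the
  perturbed first row causes the only one.
\<close>

lemma eigenvalue_if_sin_relation: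
  fixes \<gamma> s :: complex
  assumes "n \<ge> 1" and "sin s \<noteq> 0"
    and rel: "sin (of_nat (n + 1) * s) + \<i> * \<gamma> * sin (of_nat n * s) = 0"
  shows "eigenvalue (A_mat \<gamma> n) (psi s)"
proof -
  define f where "f k = (- \<i>) ^ k * sin ((of_nat n - of_nat k) * s)" for k :: nat
  define v where "v = vec n f"
  have A: "A_mat \<gamma> n \<in> carrier_mat n n"
    by (simp add: A_mat_def T_mat_def E11_mat_def)
  have step: "f k - f (k + 2) = psi s * f (k + 1)" for k
  proof -
    define a where "a = (of_nat n - of_nat (k + 1)) * s"
    have "(of_nat n - of_nat k) * s = a + s" "(of_nat n - of_nat (k + 2)) * s = a - s"
      by (simp_all add: a_def algebra_simps)
    hence "f k = (- \<i>) ^ k * sin (a + s)" "f (k + 2) = - ((- \<i>) ^ k) * sin (a - s)"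
      by (simp_all add: f_def)
    moreover have "f (k + 1) = - \<i> * (- \<i>) ^ k * sin a"
      by (simp add: f_def a_def)
    ultimately show ?thesis
      unfolding psi_def by (simp add: sin_add sin_diff algebra_simps)
  qed
  have first: "\<gamma> * f 0 - f 1 = psi s * f 0"
  proof -
    have "sin (of_nat (n + 1) * s) = sin (of_nat n * s) * cos s + cos (of_nat n * s) * sin s"
      by (simp add: algebra_simps sin_add)
    hence "\<gamma> * sin (of_nat n * s)
        = \<i> * (sin (of_nat n * s) * cos s + cos (of_nat n * s) * sin s)"
      using arg_cong[OF rel, of "\<lambda>x. \<i> * x"] by (simp add: algebra_simps)
    thus ?thesis
      by (simp add: f_def psi_def sin_diff left_diff_distrib algebra_simps)
  qed
  have last: "f n = 0"
    by (simp add: f_def)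
  have "A_mat \<gamma> n *\<^sub>v v = psi s \<cdot>\<^sub>v v"
  proof (rule eq_vecI)
    fix r assume "r < dim_vec (psi s \<cdot>\<^sub>v v)"
    hence r: "r < n" by (simp add: v_def)
    have "(A_mat \<gamma> n *\<^sub>v v) $ r = (\<Sum>k<n. A_mat \<gamma> n $$ (r, k) * f k)"
      using A r by (simp add: scalar_prod_def v_def lessThan_atLeast0)
    also have "\<dots> = (\<Sum>k<n. (if r = k + 1 then f k else 0) - (if k = r + 1 then f k else 0)
        + (if k = 0 then if r = 0 then \<gamma> * f k else 0 else 0))"
      using r by (intro sum.cong) (auto simp: A_mat_def T_mat_def E11_mat_def)
    also have "\<dots> = (\<Sum>k<n. if r = k + 1 then f k else 0) - (if r + 1 < n then f (r + 1) else 0)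
        + (if r = 0 then \<gamma> * f 0 else 0)"
      using r by (simp add: sum.distrib sum_subtractf)
    also have "(\<Sum>k<n. if r = k + 1 then f k else 0) = (if r = 0 then 0 else f (r - 1))"
      using r by (cases r) simp_all
    \<comment> \<open>The value \<open>f n = 0\<close>, just outside the vector, lets the last row be treated like the others.\<close>
    also have "(if r + 1 < n then f (r + 1) else 0) = f (r + 1)"
    proof (cases "r + 1 < n")
      case False
      with r have "r + 1 = n" by simp
      with last False show ?thesis by simp
    qed simp
    also have "(if r = 0 then 0 else f (r - 1)) - f (r + 1) + (if r = 0 then \<gamma> * f 0 else 0)
        = psi s * f r"
      using first step[of "r - 1"] by (cases r) (simp_all add: algebra_simps)
    finally show "(A_mat \<gamma> n *\<^sub>v v) $ r = (psi s \<cdot>\<^sub>v v) $ r"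
      using r by (simp add: v_def)
  qed (use A in \<open>simp add: v_def\<close>)
  moreover have "v \<noteq> 0\<^sub>v n"
  proof
    assume "v = 0\<^sub>v n"
    hence "v $ (n - 1) = 0" using assms(1) by simp
    hence "f (n - 1) = 0" using assms(1) by (simp add: v_def)
    thus False using assms(1,2) by (simp add: f_def of_nat_diff)
  qed
  ultimately show ?thesis
    using A unfolding eigenvalue_def eigenvector_def by (intro exI[of _ v]) (simp add: v_def)
qed

text \<open>
  Multiplying the hypothesis by \<open>exp (- \<i> (n + 1) s)\<close> and clearing the denominator gives two sides that
  \<open>s \<mapsto> - s\<close> exchanges; their difference is \<open>2 \<i>\<close> times the sine expression.
\<close>

lemma sin_relation_if_exp_eq:
  fixes \<gamma> s :: complex
  assumes "1 + \<i> * \<gamma> * exp (- \<i> * s) \<noteq> 0"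
    and "exp (2 * \<i> * (of_nat (n + 1) * s))
       = (1 + \<i> * \<gamma> * exp (\<i> * s)) / (1 + \<i> * \<gamma> * exp (- \<i> * s))"
  shows "sin (of_nat (n + 1) * s) + \<i> * \<gamma> * sin (of_nat n * s) = 0"
proof -
  define m where "m = of_nat (n + 1) * s"
  have eq: "exp (2 * \<i> * m) * (1 + \<i> * \<gamma> * exp (- \<i> * s)) = 1 + \<i> * \<gamma> * exp (\<i> * s)"
    using assms by (simp add: m_def)
  have "exp (- (\<i> * m)) * exp (2 * \<i> * m) = exp (\<i> * m)"
    by (simp flip: exp_add)
  hence "exp (\<i> * m) * (1 + \<i> * \<gamma> * exp (- \<i> * s))
      = exp (- (\<i> * m)) * (1 + \<i> * \<gamma> * exp (\<i> * s))"
    by (metis eq mult.assoc)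
  moreover have "exp (\<i> * m) * exp (- \<i> * s) = exp (\<i> * (of_nat n * s))"
    "exp (- (\<i> * m)) * exp (\<i> * s) = exp (- (\<i> * (of_nat n * s)))"
    by (simp_all add: m_def algebra_simps flip: exp_add)
  ultimately have "exp (\<i> * m) - exp (- (\<i> * m))
      + \<i> * \<gamma> * (exp (\<i> * (of_nat n * s)) - exp (- (\<i> * (of_nat n * s)))) = 0"
    by (simp add: algebra_simps)
  moreover have "sin m + \<i> * \<gamma> * sin (of_nat n * s) = (exp (\<i> * m) - exp (- (\<i> * m))
      + \<i> * \<gamma> * (exp (\<i> * (of_nat n * s)) - exp (- (\<i> * (of_nat n * s))))) / (2 * \<i>)"
    unfolding sin_exp_eq add_divide_distrib times_divide_eq_right ..
  ultimately show ?thesis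
    by (simp add: m_def)
qed

section \<open>Lipschitz bounds for the phase function\<close>

lemma cmod_exp_ii_le:
  assumes "\<bar>Im z\<bar> \<le> Y" and "c = cmod \<gamma> * exp Y"
  shows "cmod (\<i> * \<gamma> * exp (\<i> * z)) \<le> c" and "cmod (\<i> * \<gamma> * exp (- \<i> * z)) \<le> c"
  using assms by (auto simp: norm_mult intro!: mult_left_mono)

text \<open>
  Both arguments lie in \<open>(-\<pi>/2, \<pi>/2)\<close>, so their difference is still the principal one.
\<close>

lemma Ln_divide_Re_pos:
  assumes "Re a > 0" and "Re b > 0"
  shows "Ln (a / b) = Ln a - Ln b"
proof (rule Ln_unique)
  have nz: "a \<noteq> 0" "b \<noteq> 0" using assms by auto
  thus "exp (Ln a - Ln b) = a / b" by (simp add: exp_diff)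
  have "\<bar>Im (Ln a)\<bar> < pi / 2" "\<bar>Im (Ln b)\<bar> < pi / 2"
    using assms nz Re_Ln_pos_lt by blast+
  thus "- pi < Im (Ln a - Ln b)" "Im (Ln a - Ln b) \<le> pi" by auto
qed

lemma Re_one_plus_pos:
  fixes u :: complex
  assumes "cmod u \<le> c" and "c < 1"
  shows "Re (1 + u) > 0"
  using assms abs_Re_le_cmod[of u] by simp

text \<open>
  Splitting the logarithm reduces questions about \<open>\<vartheta>\<close> to \<open>Ln (1 + u)\<close> with \<open>\<bar>u\<bar> < 1\<close>, where
  the branch cut is out of reach.
\<close>

lemma vartheta_eq_Ln_diff:
  assumes "\<bar>Im z\<bar> \<le> Y" and "cmod \<gamma> * exp Y < 1"
  shows "vartheta \<gamma> z
    = - (\<i> / 2) * (Ln (1 + \<i> * \<gamma> * exp (\<i> * z)) - Ln (1 + \<i> * \<gamma> * exp (- \<i> * z)))"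
  unfolding vartheta_def
  using Ln_divide_Re_pos[OF Re_one_plus_pos Re_one_plus_pos] cmod_exp_ii_le[OF assms(1) refl] assms(2)
  by metis

lemma norm_divide_one_plus_le:
  fixes u :: complex
  assumes "cmod u \<le> c" and "c < 1"
  shows "cmod (u / (1 + u)) \<le> c / (1 - c)"
proof -
  have "1 - c \<le> cmod (1 + u)"
    using norm_diff_ineq[of 1 u] assms by simp
  thus ?thesis
    using assms by (simp add: norm_divide) (intro frac_le, auto intro: order_trans[OF norm_ge_zero])
qed

text \<open>
  The factors \<open>\<plusminus> \<i>\<close> from differentiating \<open>exp (\<plusminus> \<i> z)\<close> cancel against the prefactor \<open>- \<i> / 2\<close>,
  so \<open>\<vartheta>' = (u / (1 + u) + v / (1 + v)) / 2\<close> with \<open>\<bar>u\<bar>, \<bar>v\<bar> \<le> c\<close>. The strip is convex, and the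
  mean value inequality applies.
\<close>

lemma vartheta_Lipschitz:
  assumes "\<bar>Im x\<bar> \<le> Y" and "\<bar>Im y\<bar> \<le> Y" and c: "c = cmod \<gamma> * exp Y" "c < 1"
  shows "cmod (vartheta \<gamma> x - vartheta \<gamma> y) \<le> c / (1 - c) * cmod (x - y)"
proof -
  let ?u = "\<lambda>z. \<i> * \<gamma> * exp (\<i> * z)" and ?v = "\<lambda>z. \<i> * \<gamma> * exp (- \<i> * z)"
  let ?S = "{z. \<bar>Im z\<bar> \<le> Y}"
  let ?T = "\<lambda>z. - (\<i> / 2) * (Ln (1 + ?u z) - Ln (1 + ?v z))"
  let ?D = "\<lambda>z. (1 / 2) * (?u z / (1 + ?u z) + ?v z / (1 + ?v z))"
  have "?S = {z. Im z \<le> Y} \<inter> {z. Im z \<ge> - Y}" by auto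
  hence "convex ?S"
    by (simp add: convex_Int convex_halfspace_Im_le convex_halfspace_Im_ge)
  moreover have "(?T has_field_derivative ?D z) (at z within ?S)" if "z \<in> ?S" for z
  proof -
    have Re: "Re (1 + ?u z) > 0" "Re (1 + ?v z) > 0"
      using cmod_exp_ii_le[of z Y c \<gamma>] that c Re_one_plus_pos by blast+
    hence "1 + ?u z \<notin> \<real>\<^sub>\<le>\<^sub>0" "1 + ?v z \<notin> \<real>\<^sub>\<le>\<^sub>0"
      by (auto simp: complex_nonpos_Reals_iff)
    moreover have "1 + ?u z \<noteq> 0" "1 + ?v z \<noteq> 0"
      using Re by (metis less_irrefl zero_complex.simps(1))+
    ultimately show ?thesis
      by (auto intro!: derivative_eq_intros simp: divide_simps) (simp add: algebra_simps)
  qed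
  moreover have "cmod (?D z) \<le> c / (1 - c)" if "z \<in> ?S" for z
  proof -
    have "cmod (?u z / (1 + ?u z)) \<le> c / (1 - c)" "cmod (?v z / (1 + ?v z)) \<le> c / (1 - c)"
      using cmod_exp_ii_le[of z Y c \<gamma>] that c norm_divide_one_plus_le by blast+
    hence "cmod (?u z / (1 + ?u z) + ?v z / (1 + ?v z)) \<le> 2 * (c / (1 - c))"
      using norm_triangle_mono by fastforce
    thus ?thesis
      unfolding norm_mult by (simp add: mult.commute)
  qed
  ultimately have "cmod (?T x - ?T y) \<le> c / (1 - c) * cmod (x - y)"
    by (rule field_differentiable_bound) (use assms in auto)
  thus ?thesis
    using assms by (simp only: vartheta_eq_Ln_diff[OF assms(1)] vartheta_eq_Ln_diff[OF assms(2)])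
qed

text \<open>
  This says that \<open>(1 - g) / 2 \<le> ln (1 / g) / 2\<close>: the strip of half-width \<open>(1 - g) / 2\<close> lies in the
  inner half of the strip on which \<open>\<vartheta>\<close> is holomorphic. Halving the width is what leaves a
  factor \<open>sqrt g\<close> in the Lipschitz constant.
\<close>

lemma exp_half_gap_le_sqrt:
  fixes g :: real
  assumes "0 < g"
  shows "g * exp ((1 - g) / 2) \<le> sqrt g"
proof (rule real_le_rsqrt)
  have "(g * exp ((1 - g) / 2))\<^sup>2 = g * (g * exp (1 - g))"
    by (simp add: power_mult_distrib power2_eq_square flip: exp_add)
  also have "g * exp (1 - g) \<le> exp (g - 1) * exp (1 - g)"
    using exp_ge_add_one_self[of "g - 1"] by (intro mult_right_mono) auto
  hence "g * (g * exp (1 - g)) \<le> g"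
    using assms by (simp flip: exp_add)
  finally show "(g * exp ((1 - g) / 2))\<^sup>2 \<le> g" .
qed

lemma vartheta_Lipschitz_middle_strip:
  assumes "0 < cmod \<gamma>" "cmod \<gamma> < 1"
    and "\<bar>Im x\<bar> \<le> (1 - cmod \<gamma>) / 2" and "\<bar>Im y\<bar> \<le> (1 - cmod \<gamma>) / 2"
  shows "cmod (vartheta \<gamma> x - vartheta \<gamma> y)
    \<le> 2 * sqrt (cmod \<gamma>) / (1 - cmod \<gamma>) * cmod (x - y)"
proof -
  define g where "g = cmod \<gamma>"
  define c where "c = g * exp ((1 - g) / 2)"
  have g: "0 < g" "g < 1" "sqrt g < 1" using assms by (simp_all add: g_def)
  have cs: "c \<le> sqrt g" using exp_half_gap_le_sqrt g by (simp add: c_def)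
  with g have "c < 1" by linarith
  have "c / (1 - c) \<le> sqrt g / (1 - sqrt g)"
    using cs g by (intro frac_le) auto
  also have "\<dots> = sqrt g * (1 + sqrt g) / (1 - g)"
    using g by (simp add: divide_simps) (simp add: algebra_simps)
  also have "\<dots> \<le> 2 * sqrt g / (1 - g)"
    using g by (intro divide_right_mono) auto
  finally have L: "c / (1 - c) \<le> 2 * sqrt g / (1 - g)" .
  have "cmod (vartheta \<gamma> x - vartheta \<gamma> y) \<le> c / (1 - c) * cmod (x - y)"
    using assms \<open>c < 1\<close> by (intro vartheta_Lipschitz[where Y = "(1 - g) / 2"]) (auto simp: c_def g_def)
  also have "\<dots> \<le> 2 * sqrt g / (1 - g) * cmod (x - y)"
    using L by (intro mult_right_mono) auto
  finally show ?thesis by (simp add: g_def)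
qed

text \<open>
  Comparison with \<open>\<vartheta> 0 = 0\<close> along the real axis, with \<open>\<pi>\<close> rounded up to \<open>4\<close>.
\<close>

lemma cmod_vartheta_real_le:
  assumes "cmod \<gamma> < 1" and "0 \<le> d" "d \<le> pi"
  shows "cmod (vartheta \<gamma> (of_real d)) \<le> 4 * (cmod \<gamma> / (1 - cmod \<gamma>))"
proof -
  have "Re (1 + \<i> * \<gamma>) > 0"
    using assms(1) by (intro Re_one_plus_pos) (auto simp: norm_mult)
  hence "1 + \<i> * \<gamma> \<noteq> 0"
    by (metis less_irrefl zero_complex.simps(1))
  hence "vartheta \<gamma> 0 = 0"
    by (simp add: vartheta_def)
  hence "cmod (vartheta \<gamma> (of_real d)) \<le> cmod \<gamma> / (1 - cmod \<gamma>) * d"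
    using vartheta_Lipschitz[of "of_real d" 0 0 "cmod \<gamma>" \<gamma>] assms by simp
  also have "\<dots> \<le> cmod \<gamma> / (1 - cmod \<gamma>) * 4"
    using assms pi_less_4 by (intro mult_left_mono) auto
  finally show ?thesis by (simp add: mult.commute)
qed

section \<open>Fixed points and eigenvalues\<close>

theorem theorem2:
  fixes \<gamma> :: complex and n j :: nat
  assumes "0 < cmod \<gamma>" and "cmod \<gamma> < 1"
    and "real n \<ge> N_const \<gamma>"
    and "j \<in> {1..n}"
  shows "(\<exists>!s. s \<in> B_disk \<gamma> n j \<and>
            s = of_nat j * of_real pi / (of_nat n + 1) + vartheta \<gamma> s / (of_nat n + 1)) \<and>
         (\<forall>s. s \<in> B_disk \<gamma> n j \<and>
            s = of_nat j * of_real pi / (of_nat n + 1) + vartheta \<gamma> s / (of_nat n + 1) \<longrightarrow>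
            eigenvalue (A_mat \<gamma> n) (psi s))"
proof -
  define g where "g = cmod \<gamma>"
  define m where "m = real n + 1"
  define \<Phi> where "\<Phi> z = of_nat j * of_real pi / (of_nat n + 1) + vartheta \<gamma> z / (of_nat n + 1)"
    for z :: complex
  define d where "d = d_pt n j"
  define p where "p = p_pt \<gamma> n j"
  define r where "r = M_const \<gamma> / m\<^sup>2"
  define q where "q = 2 * sqrt g / ((1 - g) * m)"
  have g: "0 < g" "g < 1" "0 < sqrt g" "sqrt g < 1" using assms by (simp_all add: g_def)
  have m: "m \<ge> 1" by (simp add: m_def)
  have n: "n \<ge> 1" using assms(4) by simp
  have n1: "of_nat n + 1 = complex_of_real m" by (simp add: m_def)
  have d_eq: "complex_of_real d = of_nat j * of_real pi / (of_nat n + 1)"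
    by (simp add: d_def d_pt_def)
  have p_\<Phi>: "p = \<Phi> (of_real d)"
    by (simp add: p_def p_pt_def \<Phi>_def d_eq flip: d_def)
  have d_range: "0 < d" "d < pi"
  proof -
    show "0 < d" using assms(4) by (simp add: d_def d_pt_def)
    have "d = (real j / (real n + 1)) * pi" by (simp add: d_def d_pt_def)
    also have "\<dots> < 1 * pi" using assms(4) by (intro mult_strict_right_mono) auto
    finally show "d < pi" by simp
  qed
  have m_large: "16 \<le> m * (1 - g)\<^sup>2"
  proof -
    have "16 \<le> real n * (1 - g)\<^sup>2"
      using assms(3) g by (simp add: N_const_def g_def field_simps)
    also have "\<dots> \<le> m * (1 - g)\<^sup>2"
      by (intro mult_right_mono) (auto simp: m_def)
    finally show ?thesis .
  qed
  have inv_m: "1 / m \<le> (1 - g)\<^sup>2 / 16"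
    using m_large m by (simp add: field_simps)
  have r_pos: "0 < r" using g m by (simp add: r_def M_const_def g_def)
  have r_le: "r \<le> (1 - g) / 4"
  proof -
    have cancel: "64 * t / h ^ 3 * (h\<^sup>2 / 16)\<^sup>2 = t * (h / 4)" for t h :: real
      by (cases "h = 0") (simp_all add: field_simps eval_nat_numeral)
    have "r = 64 * sqrt g / (1 - g) ^ 3 * (1 / m)\<^sup>2"
      by (simp add: r_def M_const_def g_def power_divide)
    also have "\<dots> \<le> 64 * sqrt g / (1 - g) ^ 3 * ((1 - g)\<^sup>2 / 16)\<^sup>2"
      using inv_m g m by (intro mult_left_mono power_mono) auto
    also have "\<dots> = sqrt g * ((1 - g) / 4)"
      by (rule cancel)
    also have "\<dots> \<le> 1 * ((1 - g) / 4)"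
      using g by (intro mult_right_mono) auto
    finally show ?thesis by simp
  qed
  have q: "0 \<le> q" "q \<le> 1 / 8"
  proof -
    show "0 \<le> q" using g m by (simp add: q_def)
    have "q = 2 * sqrt g / (1 - g) * (1 / m)" by (simp add: q_def)
    also have "\<dots> \<le> 2 * sqrt g / (1 - g) * ((1 - g)\<^sup>2 / 16)"
      using inv_m g by (intro mult_left_mono) auto
    also have "\<dots> = sqrt g * (1 - g) / 8"
      using g by (simp add: field_simps power2_eq_square)
    also have "\<dots> \<le> 1 * 1 / 8"
      using g by (intro divide_right_mono mult_mono) auto
    finally show "q \<le> 1 / 8" by simp
  qed
  have dist_pd: "cmod (p - of_real d) \<le> 4 * (g / (1 - g)) / m"
  proof -
    have "p - of_real d = vartheta \<gamma> (of_real d) / of_real m"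
      by (simp add: p_\<Phi> \<Phi>_def n1 flip: d_eq[unfolded n1])
    hence "cmod (p - of_real d) = cmod (vartheta \<gamma> (of_real d)) / m"
      using m by (simp add: norm_divide)
    also have "\<dots> \<le> 4 * (g / (1 - g)) / m"
      using cmod_vartheta_real_le[of \<gamma> d] assms(2) d_range m
      unfolding g_def by (intro divide_right_mono) auto
    finally show ?thesis .
  qed
  have dist_pd_le: "cmod (p - of_real d) \<le> (1 - g) / 4"
  proof -
    have "4 * (g / (1 - g)) / m \<le> 4 * (g / (1 - g)) * ((1 - g)\<^sup>2 / 16)"
      using mult_left_mono[OF inv_m, of "4 * (g / (1 - g))"] g by simp
    also have "\<dots> = g * ((1 - g) / 4)"
      using g by (simp add: field_simps power2_eq_square)
    also have "\<dots> \<le> 1 * ((1 - g) / 4)"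
      using g by (intro mult_right_mono) auto
    finally show ?thesis using dist_pd by simp
  qed
  \<comment> \<open>The radius and the distance from the centre to the real axis use up one half of the
    half-width of the strip each.\<close>
  have strip: "\<bar>Im z\<bar> \<le> (1 - g) / 2" if "z \<in> ball p r" for z
  proof -
    have "\<bar>Im z\<bar> = \<bar>Im (z - of_real d)\<bar>" by simp
    also have "\<dots> \<le> cmod (z - of_real d)" by (rule abs_Im_le_cmod)
    also have "\<dots> \<le> cmod (z - p) + cmod (p - of_real d)"
      using norm_triangle_ineq[of "z - p" "p - of_real d"] by simp
    also have "\<dots> \<le> (1 - g) / 4 + (1 - g) / 4"
      using that r_le dist_pd_le by (intro add_mono) (auto simp: dist_norm norm_minus_commute)
    finally show ?thesis by simp
  qed
  have contr: "dist (\<Phi> x) (\<Phi> y) \<le> q * dist x y"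
    if "\<bar>Im x\<bar> \<le> (1 - g) / 2" "\<bar>Im y\<bar> \<le> (1 - g) / 2" for x y
  proof -
    have "dist (\<Phi> x) (\<Phi> y) = cmod (vartheta \<gamma> x - vartheta \<gamma> y) / m"
      using m by (simp add: \<Phi>_def n1 dist_norm norm_divide flip: diff_divide_distrib)
    also have "\<dots> \<le> (2 * sqrt g / (1 - g) * cmod (x - y)) / m"
      using vartheta_Lipschitz_middle_strip[of \<gamma> x y] that assms m
      by (intro divide_right_mono) (auto simp: g_def)
    finally show ?thesis by (simp add: q_def dist_norm)
  qed
  \<comment> \<open>Completeness needs a closed disk; one of half the radius stays inside the open disk and is
    still large enough to be mapped into itself.\<close>
  have half_in: "z \<in> ball p r" if "z \<in> cball p (r / 2)" for z
    using that r_pos by auto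
  have self_map: "\<Phi> z \<in> cball p (r / 2)" if "z \<in> cball p (r / 2)" for z
  proof -
    have "dist (\<Phi> z) p \<le> q * dist z (of_real d)"
      unfolding p_\<Phi> using strip[OF half_in[OF that]] g by (intro contr) auto
    also have "\<dots> \<le> q * (r / 2 + 4 * (g / (1 - g)) / m)"
      using q that dist_pd dist_triangle[of z "of_real d" p]
      by (intro mult_left_mono) (auto simp: dist_norm norm_minus_commute)
    also have "\<dots> = q * (r / 2) + q * (4 * (g / (1 - g)) / m)"
      by (simp add: algebra_simps)
    also have "\<dots> \<le> 1 / 8 * (r / 2) + r / 8"
    proof (intro add_mono)
      show "q * (r / 2) \<le> 1 / 8 * (r / 2)" using q r_pos by (intro mult_right_mono) auto
      have cancel: "2 * t / (h * m) * (4 * (g / h) / m) = g * h * (64 * t / h ^ 3 / m\<^sup>2 / 8)"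
        for t h :: real
        using m by (cases "h = 0") (simp_all add: field_simps eval_nat_numeral)
      have "q * (4 * (g / (1 - g)) / m) = g * (1 - g) * (r / 8)"
        unfolding q_def r_def M_const_def g_def[symmetric] by (rule cancel)
      also have "\<dots> \<le> 1 * (r / 8)"
        using g r_pos by (intro mult_right_mono mult_le_one) auto
      finally show "q * (4 * (g / (1 - g)) / m) \<le> r / 8" by simp
    qed
    also have "\<dots> \<le> r / 2" using r_pos by simp
    finally show ?thesis by (simp add: dist_commute)
  qed
  have "\<exists>!s\<in>cball p (r / 2). \<Phi> s = s"
    using q r_pos self_map contr strip half_in
    by (intro Banach_fix[of _ q]) (auto simp: complete_eq_closed)
  then obtain s where s: "s \<in> ball p r" "s = \<Phi> s"
    using half_in by metis
  have unique: "x = s" if "x \<in> ball p r" "x = \<Phi> x" for x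
  proof -
    have "dist x s \<le> q * dist x s"
      using contr[OF strip[OF that(1)] strip[OF s(1)]] that(2) s(2) by simp
    also have "\<dots> \<le> 1 / 8 * dist x s"
      using q by (intro mult_right_mono) auto
    finally show ?thesis by simp
  qed
  have eigen: "eigenvalue (A_mat \<gamma> n) (psi x)" if x: "x \<in> ball p r" "x = \<Phi> x" for x
  proof (rule eigenvalue_if_sin_relation[OF n])
    let ?a = "1 + \<i> * \<gamma> * exp (\<i> * x)" and ?b = "1 + \<i> * \<gamma> * exp (- \<i> * x)"
    have "g * exp ((1 - g) / 2) < 1"
      using exp_half_gap_le_sqrt[of g] g by linarith
    hence "Re ?a > 0" "Re ?b > 0"
      using cmod_exp_ii_le[OF strip[OF x(1)] refl, of \<gamma>] Re_one_plus_pos unfolding g_def by blast+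
    hence ab: "?a \<noteq> 0" "?b \<noteq> 0"
      by (metis less_irrefl zero_complex.simps(1))+
    have eq: "of_nat (n + 1) * x = of_nat j * of_real pi + vartheta \<gamma> x"
    proof -
      have "of_nat (n + 1) * x = of_nat (n + 1) * \<Phi> x" using x(2) by simp
      also have "\<dots> = of_nat j * of_real pi + vartheta \<gamma> x"
        using m n1 by (simp add: \<Phi>_def add.commute flip: add_divide_distrib)
      finally show ?thesis .
    qed
    show "sin x \<noteq> 0"
    proof
      assume "sin x = 0"
      \<comment> \<open>At a zero of the sine the two exponentials agree and the logarithm in \<open>\<vartheta>\<close> is \<open>Ln 1\<close>.\<close>
      hence "exp (\<i> * x) = exp (- \<i> * x)"
        by (simp add: sin_exp_eq)
      hence "vartheta \<gamma> x = 0"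
        using ab by (simp add: vartheta_def)
      hence "x = of_real d"
        using x(2) by (simp add: \<Phi>_def d_eq)
      hence "sin d = 0"
        using \<open>sin x = 0\<close> by (metis of_real_eq_0_iff sin_of_real)
      thus False
        using sin_gt_zero[OF d_range] by simp
    qed
    have "exp (2 * \<i> * (of_nat (n + 1) * x)) = exp (2 * of_nat j * of_real pi * \<i> + Ln (?a / ?b))"
      unfolding eq vartheta_def by (simp add: algebra_simps)
    also have "\<dots> = ?a / ?b"
    proof -
      have "exp (2 * of_nat j * of_real pi * \<i>) = (1 :: complex)"
        using exp_integer_2pi[of "of_nat j"] by simp
      thus ?thesis using ab by (simp add: exp_add)
    qed
    finally show "sin (of_nat (n + 1) * x) + \<i> * \<gamma> * sin (of_nat n * x) = 0"
      using sin_relation_if_exp_eq[of \<gamma> x n] ab(2) by blast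
  qed
  have B: "B_disk \<gamma> n j = ball p r"
    by (simp add: B_disk_def p_def r_def m_def)
  show ?thesis
    unfolding B \<Phi>_def[symmetric] using s unique eigen by blast
qed

end
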